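(* Let $V$ be a vector space over $\mathbb{Q}$ with $|V|\geq\aleph_n$, where $2\leq n<\omega$, and let $f:V\to\omega$ be any function. Then there is $x\in V$ such that $|S_x|\geq 2^n-1$, where $S_x$ is the set of unordered pairs $\{h,-h\}$ with $h\in V$, $h\neq 0$, and $f(x-h)=f(x+h)$.
   Context: $\omega$ is the set of natural numbers. For $V=\mathbb{R}$ this $S_x$ corresponds to $\{h>0: f(x-h)=f(x+h)\}$. *)

theory Defs
  imports Complex_Main
begin

unbundle cardinal_syntax

text \<open>
  Each application of \<^const>\<open>cardSuc\<close> changes the type, so \<open>\<aleph>\<^sub>n\<close> cannot be written as an
  \<open>n\<close>-fold iterate. Instead, \<open>is_aleph n r\<close> says that the well-order \<open>r\<close> represents \<open>\<aleph>\<^sub>n\<close>: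
  \<open>\<aleph>\<^sub>0\<close> is the order type of the naturals and \<open>\<aleph>\<^sub>n\<^sub>+\<^sub>1\<close> is the cardinal successor
  of \<open>\<aleph>\<^sub>n\<close>. Keeping all the representatives in one type loses nothing, as
  a type that accommodates \<open>\<aleph>\<^sub>n\<^sub>+\<^sub>1\<close> also accommodates \<open>\<aleph>\<^sub>n\<close> (see \<open>aleph_leI\<close>).
\<close>

primrec is_aleph :: "nat \<Rightarrow> 'a rel \<Rightarrow> bool" where
  "is_aleph 0 r \<longleftrightarrow> r =o natLeq"
| "is_aleph (Suc n) r \<longleftrightarrow> (\<exists>r0 :: 'a rel. is_aleph n r0 \<and> r =o cardSuc r0)"

definition aleph_le :: "nat \<Rightarrow> 'a set \<Rightarrow> bool" where
  "aleph_le n A \<longleftrightarrow> (\<exists>r :: 'a rel. is_aleph n r \<and> r \<le>o |A| )"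

lemma is_aleph_Card_order: "is_aleph n r \<Longrightarrow> Card_order r"
proof (induction n arbitrary: r)
  case 0
  then show ?case
    using Card_order_ordIso[OF natLeq_Card_order] by simp
next
  case (Suc n)
  then obtain r0 :: "'a rel" where "is_aleph n r0" "r =o cardSuc r0"
    by auto
  then show ?case
    using Card_order_ordIso[OF cardSuc_Card_order[OF Suc.IH]] by blast
qed

lemma is_aleph_unique:
  fixes r :: "'a rel" and s :: "'b rel"
  shows "is_aleph n r \<Longrightarrow> is_aleph n s \<Longrightarrow> r =o s"
proof (induction n arbitrary: r s)
  case 0
  then show ?case
    by (auto intro: ordIso_transitive[OF _ ordIso_symmetric])
next
  case (Suc n)
  then obtain r0 :: "'a rel" and s0 :: "'b rel" where
    r0: "is_aleph n r0" "r =o cardSuc r0" and s0: "is_aleph n s0" "s =o cardSuc s0"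
    by auto
  have c: "cardSuc r0 =o cardSuc s0"
    using Suc.IH[OF r0(1) s0(1)] r0(1) s0(1)
    by (simp add: cardSuc_invar_ordIso is_aleph_Card_order)
  show ?case
    using ordIso_transitive[OF ordIso_transitive[OF r0(2) c] ordIso_symmetric[OF s0(2)]] .
qed

lemma is_aleph_transfer:
  fixes r :: "'a rel" and A :: "'b set"
  shows "is_aleph n r \<Longrightarrow> r \<le>o |A| \<Longrightarrow> \<exists>s :: 'b rel. is_aleph n s \<and> s =o r"
proof (induction n arbitrary: r)
  case 0
  then obtain s :: "'b rel" where s: "r =o s"
    using internalize_ordLeq[of r "|A|"] by blast
  then show ?case
    using 0 ordIso_transitive[OF ordIso_symmetric[OF s]] ordIso_symmetric[OF s] by auto
next
  case (Suc n)
  then obtain r0 :: "'a rel" where r0: "is_aleph n r0" "r =o cardSuc r0"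
    by auto
  have "r0 \<le>o |A|"
    using ordLeq_transitive[OF ordLeq_ordIso_trans[OF
        cardSuc_ordLeq[OF is_aleph_Card_order[OF r0(1)]] ordIso_symmetric[OF r0(2)]]
        Suc.prems(2)] .
  then obtain s0 :: "'b rel" where s0: "is_aleph n s0" "s0 =o r0"
    using Suc.IH r0(1) by blast
  obtain s :: "'b rel" where s: "r =o s"
    using Suc.prems(2) internalize_ordLeq[of r "|A|"] by blast
  have c: "cardSuc s0 =o cardSuc r0"
    using s0 r0(1) by (simp add: cardSuc_invar_ordIso is_aleph_Card_order)
  have "s =o cardSuc s0"
    using ordIso_transitive[OF ordIso_transitive[OF ordIso_symmetric[OF s] r0(2)]
        ordIso_symmetric[OF c]] .
  then show ?case
    using ordIso_symmetric[OF s] s0(1) by auto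
qed

lemma aleph_leI:
  fixes r :: "'a rel" and A :: "'b set"
  assumes "is_aleph n r" "r \<le>o |A|"
  shows "aleph_le n A"
  using is_aleph_transfer[OF assms] ordIso_ordLeq_trans[OF _ assms(2)]
  unfolding aleph_le_def by blast

definition sym_pairs :: "('v::ab_group_add \<Rightarrow> nat) \<Rightarrow> 'v \<Rightarrow> 'v set set" where
  "sym_pairs f x = {{h, - h} | h. h \<noteq> 0 \<and> f (x - h) = f (x + h)}"

end

theory Submission
  imports Defs "HOL-Library.Countable"
begin

text \<open>
  By induction on \<open>n\<close>, a family of at most \<open>\<aleph>\<^sub>n\<close> candidates \<open>(x, H)\<close> with \<open>2\<^sup>n - 1\<close> elements
  \<open>h\<close> in \<open>H\<close> suffices to find a symmetric configuration for \<^emph>\<open>every\<close> colouring. For the step, apply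
  the hypothesis to the translates \<open>f (\<cdot> + a)\<close> for \<open>\<aleph>\<^sub>n\<^sub>+\<^sub>1\<close> many \<open>a\<close>. There are only \<open>\<aleph>\<^sub>n\<close> many candidates,
  each with countably many possible colour patterns, so infinitely many \<open>a\<close> share the same \<open>(x, H)\<close> and
  the same colours at \<open>x + a\<close> and \<open>x \<plusminus> h + a\<close>. For two such elements \<open>a, b\<close>, the centre
  \<open>x + (a + b) / 2\<close> is symmetric with respect to \<open>(a - b) / 2\<close> and \<open>(a - b) / 2 \<plusminus> h\<close> for \<open>h\<close> in \<open>H\<close>;
  this gives \<open>2 (2\<^sup>n - 1) + 1\<close> elements, and they are distinct up to sign if \<open>a - b\<close> avoids a
  finite set.
\<close>

lemma finite_ordLeq_infinite: "finite A \<Longrightarrow> infinite B \<Longrightarrow> |A| \<le>o |B|"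
  using card_of_ordLeq_finite ordLeq_total card_of_Well_order by metis

text \<open>Otherwise \<open>A\<close> would be a union of finite sets indexed by the infinite set
  \<open>B\<close>, hence of size at most \<open>|B|\<close>.\<close>

lemma infinite_fibre_exists:
  assumes less: "|B| <o |A|" and inf: "infinite B" and maps: "g ` A \<subseteq> B"
  shows "\<exists>b\<in>B. infinite {a \<in> A. g a = b}"
proof (rule ccontr)
  assume "\<not> ?thesis"
  then have "\<forall>b\<in>B. |{a \<in> A. g a = b}| \<le>o |B|"
    using inf finite_ordLeq_infinite by blast
  then have "|\<Union>b\<in>B. {a \<in> A. g a = b}| \<le>o |B|"
    using inf by (intro card_of_UNION_ordLeq_infinite card_of_refl[THEN ordIso_imp_ordLeq])
  moreover have "(\<Union>b\<in>B. {a \<in> A. g a = b}) = A"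
    using maps by auto
  ultimately show False
    using less not_ordLess_ordLeq by metis
qed

lemma is_aleph_infinite_Field: "is_aleph n r \<Longrightarrow> infinite (Field r)"
proof (induction n arbitrary: r)
  case 0
  then have "|Field r| =o |Field natLeq|"
    by (simp add: card_of_cong)
  then show ?case
    using card_of_ordIso_finite Field_natLeq infinite_UNIV_nat by metis
next
  case (Suc n)
  then obtain r0 :: "'a rel" where r0: "is_aleph n r0" "r =o cardSuc r0"
    by auto
  then have "infinite (Field (cardSuc r0))"
    using Suc.IH is_aleph_Card_order cardSuc_finite by blast
  moreover have "|Field r| =o |Field (cardSuc r0)|"
    using r0(2) by (rule card_of_cong)
  ultimately show ?case
    using card_of_ordIso_finite by blast
qed

text \<open>
  The condition \<open>h + k \<noteq> 0\<close> includes \<open>h = k\<close> and hence excludes \<open>h = 0\<close>.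
\<close>

definition sym_config :: "('v::ab_group_add \<Rightarrow> nat) \<Rightarrow> 'v \<Rightarrow> 'v list \<Rightarrow> bool" where
  "sym_config f x hs \<longleftrightarrow> distinct hs \<and> (\<forall>h\<in>set hs. \<forall>k\<in>set hs. h + k \<noteq> 0) \<and>
     (\<forall>h\<in>set hs. f (x - h) = f (x + h))"

definition doubled :: "'v::ab_group_add \<Rightarrow> 'v list \<Rightarrow> 'v list" where
  "doubled d hs = d # map (\<lambda>h. d + h) hs @ map (\<lambda>h. d - h) hs"

lemma length_doubled [simp]: "length (doubled d hs) = 2 * length hs + 1"
  by (simp add: doubled_def)

text \<open>Reflection about \<open>y\<close> swaps \<open>x + h + a\<close> with
  \<open>x - h + b\<close>, and \<open>x - h + a\<close> with \<open>x + h + b\<close>. Symmetry of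
  one translate changes the sign of \<open>h\<close>, and \<open>col\<close> then exchanges
  \<open>a\<close> and \<open>b\<close>. Every entry is \<open>d - s\<close> with \<open>s\<close>
  zero or plus or minus some \<open>h\<close>, so two entries sum to zero only if
  \<open>d + d = s + t\<close>, which \<open>generic\<close> forbids.\<close>

lemma sym_config_doubled:
  fixes x y d a b :: "'v::ab_group_add"
  assumes a: "sym_config (\<lambda>v. f (v + a)) x hs" and b: "sym_config (\<lambda>v. f (v + b)) x hs"
    and col0: "f (x + a) = f (x + b)"
    and col: "\<And>h. h \<in> set hs \<Longrightarrow> f (x + h + a) = f (x + h + b)"
    and centre: "y + d = x + a" "y - d = x + b"
    and generic: "\<And>s t. s \<in> insert 0 (set hs \<union> uminus ` set hs) \<Longrightarrow>
        t \<in> insert 0 (set hs \<union> uminus ` set hs) \<Longrightarrow> d + d \<noteq> s + t"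
  shows "sym_config f y (doubled d hs)"
proof -
  have sum: "h + k \<noteq> 0" if "h \<in> set hs" "k \<in> set hs" for h k
    using a that by (auto simp: sym_config_def)
  have neq: "h \<noteq> 0" "h \<noteq> - k" if "h \<in> set hs" "k \<in> set hs" for h k
    using sum[OF that] sum[OF that(1) that(1)] by (auto simp: eq_neg_iff_add_eq_0)
  \<comment> \<open>A coincidence between entries of different blocks would force
    \<open>h = 0\<close> or \<open>h = - k\<close>.\<close>
  have "distinct (doubled d hs)"
    using a neq by (auto simp: doubled_def sym_config_def distinct_map inj_on_def
        add_eq_0_iff diff_conv_add_uminus simp del: add_uminus_conv_diff)
  moreover have "h + k \<noteq> 0" if hk: "h \<in> set (doubled d hs)" "k \<in> set (doubled d hs)" for h k
  proof
    assume 0: "h + k = 0"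
    have shift: "\<exists>s\<in>insert 0 (set hs \<union> uminus ` set hs). u = d - s"
      if u: "u \<in> set (doubled d hs)" for u
    proof -
      consider "u = d" | h where "h \<in> set hs" "u = d + h" | h where "h \<in> set hs" "u = d - h"
        using u by (auto simp: doubled_def)
      then show ?thesis
      proof cases
        case 1
        then show ?thesis by (intro bexI[of _ 0]) auto
      next
        case (2 h)
        then show ?thesis by (intro bexI[of _ "- h"]) auto
      next
        case (3 h)
        then show ?thesis by (intro bexI[of _ h]) auto
      qed
    qed
    obtain s t where s: "s \<in> insert 0 (set hs \<union> uminus ` set hs)" "h = d - s"
      and t: "t \<in> insert 0 (set hs \<union> uminus ` set hs)" "k = d - t"
      using shift[OF hk(1)] shift[OF hk(2)] by blast
    have "d + d = s + t"
      using 0 s(2) t(2) by (simp add: algebra_simps)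
    then show False
      using generic[OF s(1) t(1)] by blast
  qed
  moreover have "f (y - u) = f (y + u)" if "u \<in> set (doubled d hs)" for u
  proof -
    have antipodal: "f (x - h + a) = f (x + h + a)" "f (x - h + b) = f (x + h + b)"
      if "h \<in> set hs" for h
      using a b that by (auto simp: sym_config_def)
    have points: "y + (d + h) = x + h + a" "y - (d + h) = x - h + b"
         "y + (d - h) = x - h + a" "y - (d - h) = x + h + b" for h
      using centre by (simp_all add: algebra_simps)
    show ?thesis
      using that col0 col antipodal by (auto simp: doubled_def points centre)
  qed
  ultimately show ?thesis
    by (simp add: sym_config_def)
qed

text \<open>The order of quantifiers carries the induction: \<open>D\<close> is fixed before
  \<open>f\<close>, so all translates of a colouring draw their candidates from the same small
  family.\<close>

lemma universal_sym_configs: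
  fixes half :: "'v::ab_group_add \<Rightarrow> 'v" and r :: "'v rel"
  assumes half_add: "\<And>u v. half (u + v) = half u + half v"
    and half_diff: "\<And>u v. half (u - v) = half u - half v"
    and half_half: "\<And>v. half v + half v = v"
  shows "is_aleph n r \<Longrightarrow> \<exists>D. |D| \<le>o r \<and>
    (\<forall>f :: 'v \<Rightarrow> nat. \<exists>(x, hs)\<in>D. length hs = 2 ^ n - 1 \<and> sym_config f x hs)"
proof (induction n arbitrary: r)
  case 0
  have "|{(0::'v, [] :: 'v list)}| \<le>o |Field r|"
    using is_aleph_infinite_Field[OF 0]
    by (intro finite_ordLeq_infinite) auto
  then have "|{(0::'v, [] :: 'v list)}| \<le>o r"
    using card_of_Field_ordIso[OF is_aleph_Card_order[OF 0]] ordLeq_ordIso_trans by blast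
  then show ?case
    by (intro exI[of _ "{(0, [])}"]) (auto simp: sym_config_def)
next
  case (Suc n)
  then obtain r0 :: "'v rel" where r0: "is_aleph n r0" and r: "r =o cardSuc r0"
    by auto
  obtain D where D: "|D| \<le>o r0"
    and univ: "\<And>f :: 'v \<Rightarrow> nat. \<exists>(x, hs)\<in>D. length hs = 2 ^ n - 1 \<and> sym_config f x hs"
    using Suc.IH[OF r0] by blast
  have card_r0: "Card_order r0" and card_r: "Card_order r"
    using is_aleph_Card_order r0 Suc.prems by blast+
  have inf_r0: "infinite (Field r0)" and inf_r: "infinite (Field r)"
    using is_aleph_infinite_Field r0 Suc.prems by blast+
  have Field_r: "|Field r| =o r"
    using card_r by (rule card_of_Field_ordIso)
  have r0_less: "r0 <o r"
    using cardSuc_greater[OF card_r0] ordIso_symmetric[OF r] ordLess_ordIso_trans by blast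
  \<comment> \<open>Since \<open>r\<close> is a relation on vectors, its field is a set of vectors
    of cardinality \<open>r\<close>; it supplies the translations.\<close>
  define A where "A = Field r"
  define mk where "mk = (\<lambda>((x::'v, hs), a, b). (x + half (a + b), doubled (half (a - b)) hs))"
  define D' where "D' = mk ` (D \<times> A \<times> A)"
  have "|D| \<le>o r"
    using D r0_less ordLeq_transitive ordLess_imp_ordLeq by blast
  then have "|D \<times> A \<times> A| \<le>o r"
    using inf_r card_r ordIso_imp_ordLeq[OF Field_r]
    unfolding A_def by (intro card_of_Times_ordLeq_infinite_Field)
  then have "|D'| \<le>o r"
    unfolding D'_def using card_of_image ordLeq_transitive by blast
  moreover have "\<exists>(y, ks)\<in>D'. length ks = 2 ^ Suc n - 1 \<and> sym_config f y ks" for f :: "'v \<Rightarrow> nat"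
  proof -
    obtain cand where cand: "\<And>a. cand a \<in> D"
      "\<And>a. length (snd (cand a)) = 2 ^ n - 1"
      "\<And>a. sym_config (\<lambda>v. f (v + a)) (fst (cand a)) (snd (cand a))"
    proof -
      have "\<exists>c. c \<in> D \<and> length (snd c) = 2 ^ n - 1 \<and>
          sym_config (\<lambda>v. f (v + a)) (fst c) (snd c)" for a
        using univ[of "\<lambda>v. f (v + a)"] unfolding case_prod_beta by blast
      then have "\<exists>cand. \<forall>a. cand a \<in> D \<and> length (snd (cand a)) = 2 ^ n - 1 \<and>
          sym_config (\<lambda>v. f (v + a)) (fst (cand a)) (snd (cand a))"
        by (intro choice allI)
      then show ?thesis
        using that by auto
    qed
    \<comment> \<open>The leading \<open>0\<close> records the colour at \<open>x + a\<close>. The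
      colours at \<open>x - h + a\<close> follow by symmetry of the translate. As a list of
      naturals, the pattern has countably many values.\<close>
    define colours where
      "colours = (\<lambda>a. map (\<lambda>h. f (fst (cand a) + h + a)) (0 # snd (cand a)))"
    define B where "B = D \<times> (UNIV :: nat list set)"
    have "|UNIV :: nat list set| \<le>o |UNIV :: nat set|"
      by (intro card_of_ordLeqI[of to_nat]) auto
    moreover have "|UNIV :: nat set| \<le>o |Field r0|"
      using inf_r0 infinite_iff_card_of_nat by blast
    ultimately have "|UNIV :: nat list set| \<le>o r0"
      using ordLeq_ordIso_trans[OF ordLeq_transitive card_of_Field_ordIso[OF card_r0]] by blast
    then have "|B| \<le>o r0"
      unfolding B_def using D inf_r0 card_r0 by (intro card_of_Times_ordLeq_infinite_Field)
    then have "|B| <o |A|"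
      unfolding A_def
      using r0_less ordIso_symmetric[OF Field_r] ordLeq_ordLess_trans ordLess_ordIso_trans by blast
    moreover have "infinite B"
      unfolding B_def using cand(1) by (auto simp: finite_cartesian_product_iff infinite_UNIV_listI)
    moreover have "(\<lambda>a. (cand a, colours a)) ` A \<subseteq> B"
      using cand(1) by (auto simp: B_def)
    ultimately obtain c w where fibre: "infinite {a \<in> A. (cand a, colours a) = (c, w)}"
      using infinite_fibre_exists[of B A "\<lambda>a. (cand a, colours a)"] by auto
    define S where "S = {a \<in> A. (cand a, colours a) = (c, w)}"
    have S: "infinite S" "\<And>a. a \<in> S \<Longrightarrow> a \<in> A \<and> cand a = c \<and> colours a = w"
      using fibre by (auto simp: S_def)
    obtain x hs where c: "c = (x, hs)"
      by fastforce
    obtain a where a: "a \<in> S"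
      using S(1) by fastforce
    \<comment> \<open>The values of \<open>b\<close> to avoid are those with
      \<open>a - b = s + t\<close> for \<open>s\<close>, \<open>t\<close> in \<open>P\<close>, where
      \<open>a - b\<close> is twice the new \<open>d\<close>. They are finitely many, so the
      infinite \<open>S\<close> contains another.\<close>
    define P where "P = insert 0 (set hs \<union> uminus ` set hs)"
    have "finite ((\<lambda>(s, t). a - (s + t)) ` (P \<times> P))"
      by (simp add: P_def)
    then have "\<not> S \<subseteq> (\<lambda>(s, t). a - (s + t)) ` (P \<times> P)"
      using S(1) rev_finite_subset by metis
    then obtain b where b: "b \<in> S" "b \<notin> (\<lambda>(s, t). a - (s + t)) ` (P \<times> P)"
      unfolding subset_iff not_all not_imp by (elim exE conjE) (rule that)
    have config: "sym_config (\<lambda>v. f (v + u)) x hs" if "u \<in> S" for u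
      using cand(3)[of u] S(2)[OF that] c by simp
    have "colours a = colours b"
      using S(2) a b(1) by metis
    then have col: "f (x + a) = f (x + b)"
      "\<And>h. h \<in> set hs \<Longrightarrow> f (x + h + a) = f (x + h + b)"
      using S(2)[OF a] S(2)[OF b(1)] c by (auto simp: colours_def)
    have "sym_config f (x + half (a + b)) (doubled (half (a - b)) hs)"
    proof (rule sym_config_doubled[OF config[OF a] config[OF b(1)] col])
      show "x + half (a + b) + half (a - b) = x + a" "x + half (a + b) - half (a - b) = x + b"
        using half_half[of a] half_half[of b]
        by (simp_all add: half_add half_diff algebra_simps)
      fix s t
      assume "s \<in> insert 0 (set hs \<union> uminus ` set hs)" "t \<in> insert 0 (set hs \<union> uminus ` set hs)"
      then have "b \<noteq> a - (s + t)"
        using b(2) by (auto simp: P_def)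
      then show "half (a - b) + half (a - b) \<noteq> s + t"
        unfolding half_half by (auto simp: algebra_simps)
    qed
    \<comment> \<open>The new length is \<open>2 * (2 ^ n - 1) + 1 = 2 ^ Suc n - 1\<close>; as
      subtraction truncates, this rests on \<open>1 \<le> 2 ^ n\<close>.\<close>
    moreover have "length hs = 2 ^ n - 1"
      using cand(2)[of a] S(2)[OF a] c by simp
    then have "length (doubled (half (a - b)) hs) = 2 ^ Suc n - 1"
      using one_le_power[of "2::nat" n] unfolding length_doubled power_Suc by linarith
    moreover have "(x + half (a + b), doubled (half (a - b)) hs) \<in> D'"
    proof -
      have "(x, hs) \<in> D" "a \<in> A" "b \<in> A"
        using cand(1)[of a] S(2)[OF a] S(2)[OF b(1)] c by auto
      then show ?thesis
        unfolding D'_def by (intro image_eqI[of _ _ "((x, hs), a, b)"]) (auto simp: mk_def)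
    qed
    ultimately show ?thesis
      by blast
  qed
  ultimately show ?case
    by blast
qed

text \<open>No two entries sum to zero, so distinct entries give distinct pairs
  \<open>{h, - h}\<close>; the case \<open>h = k\<close> shows that entries are nonzero.\<close>

lemma length_le_card_sym_pairs:
  assumes "sym_config f x hs" and fin: "finite (sym_pairs f x)"
  shows "length hs \<le> card (sym_pairs f x)"
proof -
  have hs: "distinct hs" "\<And>h k. h \<in> set hs \<Longrightarrow> k \<in> set hs \<Longrightarrow> h + k \<noteq> 0"
    "\<And>h. h \<in> set hs \<Longrightarrow> f (x - h) = f (x + h)"
    using assms(1) by (auto simp: sym_config_def)
  have "inj_on (\<lambda>h. {h, - h}) (set hs)"
    using hs(2) by (fastforce simp: inj_on_def doubleton_eq_iff)
  moreover have "(\<lambda>h. {h, - h}) ` set hs \<subseteq> sym_pairs f x"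
    using hs(2,3) by (fastforce simp: sym_pairs_def)
  ultimately have "card (set hs) \<le> card (sym_pairs f x)"
    using fin by (rule card_inj_on_le)
  then show ?thesis
    using hs(1) by (simp add: distinct_card)
qed

text \<open>An infinite set has \<open>card\<close> equal to 0, hence the separate disjunct for
  infinitely many pairs.\<close>

theorem theorem5:
  fixes scale :: "rat \<Rightarrow> 'v::ab_group_add \<Rightarrow> 'v"
    and f :: "'v \<Rightarrow> nat"
    and n :: nat
  assumes "vector_space scale"
    and "n \<ge> 2"
    and "aleph_le n (UNIV :: 'v set)"
  shows "\<exists>x. infinite (sym_pairs f x) \<or> card (sym_pairs f x) \<ge> 2 ^ n - 1"
proof -
  interpret vector_space scale
    by fact
  obtain r :: "'v rel" where r: "is_aleph n r"
    using assms(3) by (auto simp: aleph_le_def)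
  have half: "scale (1/2) v + scale (1/2) v = v" for v
    using scale_left_distrib[of "1/2" "1/2" v] by simp
  obtain D :: "('v \<times> 'v list) set" where
    "\<forall>f :: 'v \<Rightarrow> nat. \<exists>(x, hs)\<in>D. length hs = 2 ^ n - 1 \<and> sym_config f x hs"
    using universal_sym_configs[of "scale (1/2)", OF scale_right_distrib scale_right_diff_distrib half r]
    by blast
  then obtain x hs where "length hs = 2 ^ n - 1" "sym_config f x hs"
    by blast
  then show ?thesis
    using length_le_card_sym_pairs by metis
qed

end
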